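(* Let the states $\mathbf q^{n,\ell},\mathbf q^{n+1,\ell}$ (with positive densities) satisfy, for $\ell=1,\dots,N$, the fully-discrete finite volume scheme $$\frac{\mathbf q^{n+1,\ell}-\mathbf q^{n,\ell}}{\Delta t}=-\frac{(\mathbf f_{\tilde{\mathbf p}}^{\ell+\frac12}-\mathbf f^\ell)-(\mathbf f_{\tilde{\mathbf p}}^{\ell-\frac12}-\mathbf f^\ell)}{\Delta x}+\frac{\mathbf g_{\tilde{\mathbf p}}^{\ell+\frac12}-\mathbf g_{\tilde{\mathbf p}}^{\ell-\frac12}}{\Delta x}+\tilde{\mathbf P}^\ell ,$$ with the fluxes $\mathbf f_{\tilde{\mathbf p}}^{\ell\pm\frac12}$, $\mathbf g_{\tilde{\mathbf p}}^{\ell\pm\frac12}$ and the production term $\tilde{\mathbf P}^\ell$ defined in the context. Assume that $\tilde T^\ell>0$ and $\partial^2_{\mathbf p\mathbf p}\tilde L^{\ell\pm\frac12}>0$ (positive definite). Then the scheme satisfies the fully discrete cell entropy inequality $$(\rho S)^{n+1,\ell}\ \ge\ (\rho S)^{n,\ell}-\frac{\Delta t}{\Delta x}\big(f_{\rho S}^{\ell+\frac12}-f_{\rho S}^{\ell-\frac12}\big)+\frac{\Delta t}{\Delta x}\big(g_{\rho S}^{\ell+\frac12}-g_{\rho S}^{\ell-\frac12}\big),$$ where $f_{\rho S}^{\ell\pm\frac12}$ and $g_{\rho S}^{\ell\pm\frac12}$ are the $\rho S$-components (last components) of $\mathbf f_{\tilde{\mathbf p}}^{\ell\pm\frac12}$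 and $\mathbf g_{\tilde{\mathbf p}}^{\ell\pm\frac12}$.
   Context: **Euler subsystem.** Constants $\gamma>1$, $c_v>0$. The state is $\mathbf q=(\rho,\rho v_1,\rho v_2,\rho v_3,\rho S)$ with $\rho>0$, and the total energy potential, as a function of $\mathbf q$, is $\mathcal E=\frac{\rho^\gamma}{\gamma-1}e^{S/c_v}+\frac12\rho v_iv_i$ (repeated index summed). The dual variables are $\mathbf p=\partial_{\mathbf q}\mathcal E=(\partial_\rho\mathcal E,v_1,v_2,v_3,T)$, with $T=\partial_{\rho S}\mathcal E=\frac{\rho^{\gamma-1}}{(\gamma-1)c_v}e^{S/c_v}$ and derivatives taken in the variables $\rho,\rho v_i,\rho S$. The map $\mathbf q\mapsto\mathbf p$ is a bijection from $\{\rho>0\}$ onto $\{T>0\}$, with inverse $\mathbf q(\mathbf p)$. The generating potential is $L=\mathbf p\cdot\mathbf q-\mathcal E$, regarded as a function of $\mathbf p$; it equals the pressure $p=\rho^\gamma e^{S/c_v}$. The physical flux in the $x$-direction is $\mathbf f=\partial_{\mathbf p}(v_1L)=(\rho v_1,\ \rho v_iv_1+p\,\delta_{i1},\ \rho Sv_1)$, regarded as a function of $\mathbf p$. **Grid.** One-dimensional uniform grid with cells $\Omega^\ell=[x^{\ell-\frac12},x^{\ell+\frac12}]$, $\ell=1,\dots,N$, mesh size $\Delta x>0$, time step $\Delta t>0$; states in exterior cells $\ell=0,N+1$ at both time levels are prescribed. Numerical viscosities satisfy $\epsilon^{\ell+\frac12}\ge0$. **Averages.** For $\ell=0,\dots,N+1$,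 $$\tilde{\mathbf p}^\ell=\int_0^1\partial_{\mathbf q}\mathcal E\big(\mathbf q^{n,\ell}+s(\mathbf q^{n+1,\ell}-\mathbf q^{n,\ell})\big)\,ds,$$ with last component $\tilde T^\ell$. Write $\Delta\tilde{\mathbf p}^{\ell+\frac12}=\tilde{\mathbf p}^{\ell+1}-\tilde{\mathbf p}^\ell$ and $\mathbf f^\ell=\mathbf f(\tilde{\mathbf p}^\ell)$. **Fluxes and production.** $$\mathbf f_{\tilde{\mathbf p}}^{\ell+\frac12}=\int_0^1\mathbf f\big(\tilde{\mathbf p}^\ell+s(\tilde{\mathbf p}^{\ell+1}-\tilde{\mathbf p}^\ell)\big)\,ds,\qquad \mathbf g_{\tilde{\mathbf p}}^{\ell+\frac12}=\epsilon^{\ell+\frac12}\,\partial^2_{\mathbf p\mathbf p}\tilde L^{\ell+\frac12}\,\frac{\tilde{\mathbf p}^{\ell+1}-\tilde{\mathbf p}^\ell}{\Delta x}.$$ Here $\partial^2_{\mathbf p\mathbf p}\tilde L^{\ell+\frac12}$ denotes the inverse of the Roe-type matrix $\int_0^1\partial^2_{\mathbf q\mathbf q}\mathcal E\big(\tilde{\mathbf q}^\ell+s(\tilde{\mathbf q}^{\ell+1}-\tilde{\mathbf q}^\ell)\big)ds$, with $\tilde{\mathbf q}^\ell=\mathbf q(\tilde{\mathbf p}^\ell)$. The production term is $\tilde{\mathbf P}^\ell=(0,\mathbf 0,\tilde\Pi^\ell)^T$ with $\tilde\Pi^\ell$ determined by $$\tilde{\mathbf p}^\ell\cdot\tilde{\mathbf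 P}^\ell=\tilde T^\ell\tilde\Pi^\ell=\tfrac12\epsilon^{\ell+\frac12}\frac{\Delta\tilde{\mathbf p}^{\ell+\frac12}}{\Delta x}\cdot\partial^2_{\mathbf p\mathbf p}\tilde L^{\ell+\frac12}\frac{\Delta\tilde{\mathbf p}^{\ell+\frac12}}{\Delta x}+\tfrac12\epsilon^{\ell-\frac12}\frac{\Delta\tilde{\mathbf p}^{\ell-\frac12}}{\Delta x}\cdot\partial^2_{\mathbf p\mathbf p}\tilde L^{\ell-\frac12}\frac{\Delta\tilde{\mathbf p}^{\ell-\frac12}}{\Delta x}.$$ *)

theory Defs
  imports "HOL-Analysis.Analysis"
begin

text \<open>
  A state is \<open>q = (\<rho>, \<rho> v1, \<rho> v2, \<rho> v3, \<rho> S) :: real^5\<close>, with components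
  \<open>q $ 1, \<dots>, q $ 5\<close>. In the index type \<open>5\<close> the numerals are taken modulo 5, so the
  last index is \<open>5 = 0\<close>.
\<close>

definition grad :: "(real^'n \<Rightarrow> real) \<Rightarrow> real^'n \<Rightarrow> real^'n" where
  "grad f x = (\<chi> i. frechet_derivative f (at x) (axis i 1))"

definition hessian :: "(real^'n \<Rightarrow> real) \<Rightarrow> real^'n \<Rightarrow> real^'n^'n" where
  "hessian f x = jacobian (grad f) (at x)"

text \<open>
  Symmetry is not demanded here: the matrices this is applied to are inverses of averaged
  Hessians of a smooth function, hence symmetric anyway.
\<close>
definition pos_definite :: "real^'n^'n \<Rightarrow> bool" where
  "pos_definite A \<longleftrightarrow> (\<forall>x. x \<noteq> 0 \<longrightarrow> 0 < x \<bullet> (A *v x))"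

text \<open>
  Total energy potential \<open>\<rho>\<^sup>\<gamma> exp (S / c\<^sub>v) / (\<gamma> - 1) + \<rho> v_i v_i / 2\<close> in conserved variables:
  \<open>S = q $ 5 / q $ 1\<close> and \<open>\<rho> v_i v_i = (q $ (i + 1))\<^sup>2 / q $ 1\<close>.
\<close>
definition energy :: "real \<Rightarrow> real \<Rightarrow> real^5 \<Rightarrow> real" where
  "energy \<gamma> c\<^sub>v q =
     (q $ 1) powr \<gamma> / (\<gamma> - 1) * exp ((q $ 5 / q $ 1) / c\<^sub>v)
     + 1/2 * (((q $ 2)\<^sup>2 + (q $ 3)\<^sup>2 + (q $ 4)\<^sup>2) / q $ 1)"

definition dual :: "real \<Rightarrow> real \<Rightarrow> real^5 \<Rightarrow> real^5" where
  "dual \<gamma> c\<^sub>v = grad (energy \<gamma> c\<^sub>v)"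

text \<open>The inverse map \<open>q(p)\<close>, meaningful for \<open>p $ 5 > 0\<close>, i.e. positive temperature.\<close>
definition state_of_dual :: "real \<Rightarrow> real \<Rightarrow> real^5 \<Rightarrow> real^5" where
  "state_of_dual \<gamma> c\<^sub>v = inv_into {q. 0 < q $ 1} (dual \<gamma> c\<^sub>v)"

definition gen_potential :: "real \<Rightarrow> real \<Rightarrow> real^5 \<Rightarrow> real" where
  "gen_potential \<gamma> c\<^sub>v p =
     p \<bullet> state_of_dual \<gamma> c\<^sub>v p - energy \<gamma> c\<^sub>v (state_of_dual \<gamma> c\<^sub>v p)"

text \<open>The dual component \<open>p $ 2\<close> is the velocity \<open>v1\<close>.\<close>
definition phys_flux :: "real \<Rightarrow> real \<Rightarrow> real^5 \<Rightarrow> real^5" where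
  "phys_flux \<gamma> c\<^sub>v = grad (\<lambda>p. p $ 2 * gen_potential \<gamma> c\<^sub>v p)"

definition dual_avg :: "real \<Rightarrow> real \<Rightarrow> real^5 \<Rightarrow> real^5 \<Rightarrow> real^5" where
  "dual_avg \<gamma> c\<^sub>v q q' = integral {0..1} (\<lambda>s. dual \<gamma> c\<^sub>v (q + s *\<^sub>R (q' - q)))"

definition flux_avg :: "real \<Rightarrow> real \<Rightarrow> real^5 \<Rightarrow> real^5 \<Rightarrow> real^5" where
  "flux_avg \<gamma> c\<^sub>v p p' = integral {0..1} (\<lambda>s. phys_flux \<gamma> c\<^sub>v (p + s *\<^sub>R (p' - p)))"

definition roe_matrix :: "real \<Rightarrow> real \<Rightarrow> real^5 \<Rightarrow> real^5 \<Rightarrow> real^5^5" where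
  "roe_matrix \<gamma> c\<^sub>v q q' =
     integral {0..1} (\<lambda>s. hessian (energy \<gamma> c\<^sub>v) (q + s *\<^sub>R (q' - q)))"

definition roe_inv :: "real \<Rightarrow> real \<Rightarrow> real^5 \<Rightarrow> real^5 \<Rightarrow> real^5^5" where
  "roe_inv \<gamma> c\<^sub>v p p' =
     matrix_inv (roe_matrix \<gamma> c\<^sub>v (state_of_dual \<gamma> c\<^sub>v p) (state_of_dual \<gamma> c\<^sub>v p'))"

end

theory Submission
  imports Defs
begin

text \<open>
  The last component of the scheme is the asserted inequality with the production \<open>\<sigma> l\<close> added.
  Testing the production with \<open>p l\<close> gives temperature times \<open>\<sigma> l\<close>, which equals a nonnegative
  dissipation, so \<open>\<sigma> l \<ge> 0\<close>.
\<close>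

text \<open>\<open>pos_definite\<close> speaks only of nonzero vectors; the zero vector must be
  covered too, since neighbouring averaged dual states may coincide.\<close>

lemma pos_definite_quadratic_nonneg:
  assumes "pos_definite A"
  shows "0 \<le> x \<bullet> (A *v x)"
  using assms by (cases "x = 0") (auto simp: pos_definite_def less_imp_le)

theorem theorem4:
  fixes \<gamma> c\<^sub>v \<Delta>t \<Delta>x :: real
    and N :: nat
    and q q' :: "nat \<Rightarrow> real^5"          (* cell states at time levels n and n+1 *)
    and \<epsilon> :: "nat \<Rightarrow> real"              (* index l stands for the interface l + 1/2 *)
    and \<sigma> :: "nat \<Rightarrow> real"              (* production term of the entropy equation *)
    and p f g :: "nat \<Rightarrow> real^5"
    and H :: "nat \<Rightarrow> real^5^5"
  defines "p \<equiv> \<lambda>l. dual_avg \<gamma> c\<^sub>v (q l) (q' l)"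
    and "H \<equiv> \<lambda>l. roe_inv \<gamma> c\<^sub>v (p l) (p (l + 1))"
    and "f \<equiv> \<lambda>l. flux_avg \<gamma> c\<^sub>v (p l) (p (l + 1))"
    and "g \<equiv> \<lambda>l. \<epsilon> l *\<^sub>R (H l *v ((p (l + 1) - p l) /\<^sub>R \<Delta>x))"
  assumes "\<gamma> > 1" and "c\<^sub>v > 0" and "\<Delta>t > 0" and "\<Delta>x > 0"
    and visc: "\<And>l. l \<le> N \<Longrightarrow> 0 \<le> \<epsilon> l"
    and dens: "\<And>l. l \<le> N + 1 \<Longrightarrow> 0 < q l $ 1 \<and> 0 < q' l $ 1"
    and temp: "\<And>l. l \<in> {1..N} \<Longrightarrow> 0 < p l $ 5"
    and posdef: "\<And>l. l \<in> {1..N} \<Longrightarrow> pos_definite (H l) \<and> pos_definite (H (l - 1))"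
    and prod: "\<And>l. l \<in> {1..N} \<Longrightarrow>
      p l \<bullet> axis 5 (\<sigma> l) =
        1/2 * \<epsilon> l * (((p (l + 1) - p l) /\<^sub>R \<Delta>x) \<bullet> (H l *v ((p (l + 1) - p l) /\<^sub>R \<Delta>x)))
      + 1/2 * \<epsilon> (l - 1) *
          (((p l - p (l - 1)) /\<^sub>R \<Delta>x) \<bullet> (H (l - 1) *v ((p l - p (l - 1)) /\<^sub>R \<Delta>x)))"
    and scheme: "\<And>l. l \<in> {1..N} \<Longrightarrow>
      (q' l - q l) /\<^sub>R \<Delta>t =
        - (((f l - phys_flux \<gamma> c\<^sub>v (p l)) - (f (l - 1) - phys_flux \<gamma> c\<^sub>v (p l))) /\<^sub>R \<Delta>x)
        + (g l - g (l - 1)) /\<^sub>R \<Delta>x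
        + axis 5 (\<sigma> l)"
  shows "\<forall>l\<in>{1..N}.
      q' l $ 5 \<ge> q l $ 5 - \<Delta>t / \<Delta>x * (f l $ 5 - f (l - 1) $ 5)
                        + \<Delta>t / \<Delta>x * (g l $ 5 - g (l - 1) $ 5)"
proof
  fix l assume l: "l \<in> {1..N}"
  \<comment> \<open>Index \<open>k\<close> is the interface k + 1/2, so \<open>d l\<close> and
    \<open>d (l - 1)\<close> are the jump quotients at the right and left faces of cell
    \<open>l\<close>.\<close>
  define d where "d k = (p (k + 1) - p k) /\<^sub>R \<Delta>x" for k
  have "0 \<le> 1/2 * \<epsilon> l * (d l \<bullet> (H l *v d l))
      + 1/2 * \<epsilon> (l - 1) * (d (l - 1) \<bullet> (H (l - 1) *v d (l - 1)))"
    using l visc[of l] visc[of "l - 1"] posdef[OF l]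
    by (intro add_nonneg_nonneg mult_nonneg_nonneg pos_definite_quadratic_nonneg) auto
  also have "\<dots> = p l \<bullet> axis 5 (\<sigma> l)"
    \<comment> \<open>The bound l \<ge> 1 makes the truncated subtraction harmless:
      \<open>l - 1 + 1\<close> is \<open>l\<close>.\<close>
    using prod[OF l] l by (simp add: d_def)
  also have "\<dots> = p l $ 5 * \<sigma> l"
    by (simp add: inner_axis)
  finally have "0 \<le> \<sigma> l"
    using temp[OF l] by (simp add: zero_le_mult_iff)
  moreover have "q' l $ 5 = q l $ 5 - \<Delta>t / \<Delta>x * (f l $ 5 - f (l - 1) $ 5)
      + \<Delta>t / \<Delta>x * (g l $ 5 - g (l - 1) $ 5) + \<Delta>t * \<sigma> l"
  proof -
    \<comment> \<open>The cell flux \<open>phys_flux \<gamma> c\<^sub>v (p l)\<close> occurs in both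
      fluctuations and cancels, leaving a conservative flux difference plus the production.\<close>
    have "(q' l $ 5 - q l $ 5) / \<Delta>t =
        - ((f l $ 5 - f (l - 1) $ 5) / \<Delta>x) + (g l $ 5 - g (l - 1) $ 5) / \<Delta>x + \<sigma> l"
      using arg_cong[OF scheme[OF l], of "\<lambda>v. v $ 5"]
      by (simp add: axis_def divide_inverse mult.commute)
    then show ?thesis
      using \<open>\<Delta>t > 0\<close> \<open>\<Delta>x > 0\<close> by (simp add: field_simps)
  qed
  ultimately show "q' l $ 5 \<ge> q l $ 5 - \<Delta>t / \<Delta>x * (f l $ 5 - f (l - 1) $ 5)
      + \<Delta>t / \<Delta>x * (g l $ 5 - g (l - 1) $ 5)"
    \<comment> \<open>Dropping the nonnegative term \<open>\<Delta>t * \<sigma> l\<close> turns the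
      balance into the inequality.\<close>
    using \<open>\<Delta>t > 0\<close> by simp
qed

end
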